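(* Let $n\geq 2$ and $k\geq 3$ be integers. Then $\vec{C}_{2n+1}\langle\emptyset\rangle$ is $k$-mixing and $\mathcal{D}_k(\vec{C}_{2n+1}\langle\emptyset\rangle)$ has diameter at most $4n+1+\lfloor \frac{n+1}{2}\rfloor$.
   Context: For $n\ge 2$, the cyclic circulant tournament $\vec{C}_{2n+1}\langle\emptyset\rangle$ has vertex set $\mathbb{Z}_{2n+1}$ and arcs $(a,a+j)$ for all $a\in\mathbb{Z}_{2n+1}$ and $j\in\{1,\dots,n\}$. For a digraph $D$ and positive integer $k$, a $k$-coloring of $D$ is a function $\alpha\colon V(D)\to\{1,\dots,k\}$ such that every color class $\{x:\alpha(x)=i\}$ (possibly empty) induces an acyclic subdigraph. The $k$-dicoloring graph $\mathcal{D}_k(D)$ has the $k$-colorings of $D$ as vertices, two being adjacent iff they differ on exactly one vertex. $D$ is $k$-mixing if $\mathcal{D}_k(D)$ is connected. *)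

theory Defs
  imports "Graph_Theory.Graph_Theory"
begin

text \<open>Residue classes modulo \<open>2n+1\<close> are represented by the numbers \<open>0, \<dots>, 2n\<close>.\<close>

definition cyclic_circulant_tournament :: "nat \<Rightarrow> (nat, nat \<times> nat) pre_digraph" where
  "cyclic_circulant_tournament n = with_proj
     \<lparr> pverts = {..<2 * n + 1},
       parcs = {(a, (a + j) mod (2 * n + 1)) | a j. a \<in> {..<2 * n + 1} \<and> j \<in> {1..n}} \<rparr>"

text \<open>
  Colorings are extensional functions (they take the value \<open>undefined\<close> outside the vertex set),
  so that two of them are equal iff they agree on all vertices.
\<close>

definition dicolorings :: "nat \<Rightarrow> ('a, 'b) pre_digraph \<Rightarrow> ('a \<Rightarrow> nat) set" where
  "dicolorings k D = {\<alpha> \<in> verts D \<rightarrow>\<^sub>E {1..k}.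
     \<forall>i \<in> {1..k}. acyclic (arcs_ends (D \<restriction> {x \<in> verts D. \<alpha> x = i}))}"

text \<open>The undirected dicoloring graph is the symmetric digraph with both orientations of each edge.\<close>

definition dicoloring_graph ::
    "nat \<Rightarrow> ('a, 'b) pre_digraph \<Rightarrow> ('a \<Rightarrow> nat, ('a \<Rightarrow> nat) \<times> ('a \<Rightarrow> nat)) pre_digraph" where
  "dicoloring_graph k D = with_proj
     \<lparr> pverts = dicolorings k D,
       parcs = {(\<alpha>, \<beta>). \<alpha> \<in> dicolorings k D \<and> \<beta> \<in> dicolorings k D \<and>
                  (\<exists>!x. x \<in> verts D \<and> \<alpha> x \<noteq> \<beta> x)} \<rparr>"

definition mixing :: "nat \<Rightarrow> ('a, 'b) pre_digraph \<Rightarrow> bool" where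
  "mixing k D \<longleftrightarrow> connected (dicoloring_graph k D)"

text \<open>With all arc weights 1, \<open>wf_digraph.\<mu>\<close> is the length of a shortest walk, \<open>\<infinity>\<close> if there is none.\<close>

definition diameter :: "('a, 'b) pre_digraph \<Rightarrow> ereal" where
  "diameter G = (SUP (u, v) \<in> verts G \<times> verts G. wf_digraph.\<mu> G (\<lambda>_. 1) u v)"

lemma wf_digraph_cyclic_circulant_tournament: "wf_digraph (cyclic_circulant_tournament n)"
  by unfold_locales (auto simp: cyclic_circulant_tournament_def)

lemma wf_digraph_dicoloring_graph: "wf_digraph (dicoloring_graph k D)"
  by unfold_locales (auto simp: dicoloring_graph_def)

lemma symmetric_dicoloring_graph: "symmetric (dicoloring_graph k D)"
  by (auto simp: symmetric_def sym_def dicoloring_graph_def eq_commute)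

end

theory Submission
  imports Defs
begin

text \<open>
  A vertex set of the tournament is acyclic iff it lies in a window \<open>{s, \<dots>, s + n}\<close>, since an acyclic
  set has a source \<open>s\<close>. Let \<open>i\<close> be a color used by \<open>\<alpha>\<close>, and let \<open>W\<close> and \<open>W'\<close> be windows containing the
  color classes of \<open>i\<close> in \<open>\<alpha>\<close> and \<open>\<beta>\<close>. Extending these classes to \<open>W\<close> and \<open>W'\<close> takes at most \<open>n\<close> and
  \<open>n + 1\<close> steps. The complement of a window has only \<open>n\<close> vertices, so any coloring of it is admissible;
  even one additional vertex next to it does no harm. Hence \<open>W\<close> can be rotated into \<open>W'\<close> by alternately
  releasing its first vertex to the final color and absorbing the next vertex, such that each vertex
  on which the two colorings differ is recolored exactly once. As \<open>W\<close> and \<open>W'\<close> intersect, this takes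
  at most \<open>2n\<close> steps, which gives \<open>4n + 1\<close> in total.
\<close>

section \<open>Windows\<close>

text \<open>Offsets run up to \<open>n\<close> inclusive, so a window has \<open>n + 1\<close>
  vertices. The start \<open>s\<close> is not reduced, which lets \<open>s + d\<close> and
  \<open>s + n + 1\<close> serve as starts directly.\<close>

definition window :: "nat \<Rightarrow> nat \<Rightarrow> nat set" where
  "window n s = (\<lambda>j. (s + j) mod (2 * n + 1)) ` {..n}"

lemma add_mod_inj:
  fixes N s i j :: nat
  assumes "(s + i) mod N = (s + j) mod N" "i < N" "j < N"
  shows "i = j"
  using assms
proof (induction i j rule: linorder_wlog)
  case (le i j)
  then have "N dvd (s + j) - (s + i)"
    by (metis mod_eq_dvd_iff_nat add_le_cancel_left)
  then show ?case
    using le by (auto dest: dvd_imp_le)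
qed auto

lemma offset_exists:
  fixes N s x :: nat
  assumes "x < N"
  obtains j where "j < N" "x = (s + j) mod N"
proof
  \<comment> \<open>The start \<open>s\<close> may exceed \<open>N\<close>, so it is reduced first
    to keep the natural-number subtraction from being cut off at 0.\<close>
  show "(x + (N - s mod N)) mod N < N"
    using assms by simp
  have "s mod N < N"
    using assms by simp
  then have "s mod N + (x + (N - s mod N)) = x + N"
    by simp
  then have "(s mod N + (x + (N - s mod N))) mod N = x"
    using assms by simp
  then show "x = (s + (x + (N - s mod N)) mod N) mod N"
    by (simp add: mod_simps)
qed

lemma window_subset: "window n s \<subseteq> {..<2 * n + 1}"
  by (auto simp: window_def)

lemma card_window_le: "card (window n s) \<le> n + 1"
  unfolding window_def using card_image_le[of "{..n}"] by fastforce

lemma window_mod: "window n (s mod (2 * n + 1)) = window n s"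
  by (simp add: window_def mod_simps)

text \<open>The bound on \<open>d\<close> keeps \<open>d + i\<close> below \<open>2 * n + 1\<close>
  for \<open>i \<le> n\<close>, so nothing wraps around and the congruence becomes the equation
  \<open>j = d + i\<close>.\<close>

lemma offset_in_window_iff:
  assumes "d \<le> n" "j < 2 * n + 1"
  shows "(s + j) mod (2 * n + 1) \<in> window n (s + d) \<longleftrightarrow> d \<le> j \<and> j \<le> d + n"
proof
  assume "(s + j) mod (2 * n + 1) \<in> window n (s + d)"
  then obtain i where i: "i \<le> n" "(s + j) mod (2 * n + 1) = (s + (d + i)) mod (2 * n + 1)"
    by (auto simp: window_def add.assoc)
  then have "j = d + i"
    using assms add_mod_inj[OF i(2)] by simp
  then show "d \<le> j \<and> j \<le> d + n"
    using i by simp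
next
  assume "d \<le> j \<and> j \<le> d + n"
  then show "(s + j) mod (2 * n + 1) \<in> window n (s + d)"
    unfolding window_def by (intro image_eqI[of _ _ "j - d"]) auto
qed

text \<open>The complement has the offsets \<open>n + 1\<close> to \<open>2 * n\<close> from
  \<open>s\<close>. The window starting there has one more place, which wraps around to
  \<open>s\<close> itself; this spare place is what makes the rotation possible.\<close>

lemma window_complement: "insert (s mod (2 * n + 1)) ({..<2 * n + 1} - window n s) \<subseteq> window n (s + n + 1)"
proof
  fix x assume x: "x \<in> insert (s mod (2 * n + 1)) ({..<2 * n + 1} - window n s)"
  show "x \<in> window n (s + n + 1)"
  proof (cases "x = s mod (2 * n + 1)")
    case True
    have "s + n + 1 + n = s + (2 * n + 1)"
      by simp
    then have "x = (s + n + 1 + n) mod (2 * n + 1)"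
      using True by (simp only: mod_add_self2)
    then show ?thesis
      unfolding window_def by blast
  next
    case False
    with x obtain j where j: "j < 2 * n + 1" "x = (s + j) mod (2 * n + 1)" "x \<notin> window n s"
      by (auto elim: offset_exists[of _ _ s])
    then have "n < j"
      using offset_in_window_iff[of 0 n j s] by auto
    then show ?thesis
      unfolding window_def using j by (intro image_eqI[of _ _ "j - n - 1"]) auto
  qed
qed

lemma window_Suc:
  "window n (Suc s) = insert ((s + n + 1) mod (2 * n + 1)) (window n s - {s mod (2 * n + 1)})"
\<comment> \<open>For \<open>n = 0\<close> the modulus is 1 and the offset \<open>n + 1\<close> is
  out of range for \<open>add_mod_inj\<close>.\<close>
proof (cases "n = 0")
  case True
  then show ?thesis by (auto simp: window_def)
next
  case False
  show ?thesis
  proof (rule set_eqI)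
    fix x
    show "x \<in> window n (Suc s) \<longleftrightarrow>
      x \<in> insert ((s + n + 1) mod (2 * n + 1)) (window n s - {s mod (2 * n + 1)})"
    proof (cases "x < 2 * n + 1")
      case True
      then obtain j where j: "j < 2 * n + 1" "x = (s + j) mod (2 * n + 1)"
        by (rule offset_exists)
      have "x = (s + n + 1) mod (2 * n + 1) \<longleftrightarrow> j = n + 1"
        using j False add_mod_inj[of s j "2 * n + 1" "n + 1"] by (auto simp: add.assoc)
      moreover have "x = s mod (2 * n + 1) \<longleftrightarrow> j = 0"
        using j add_mod_inj[of s j "2 * n + 1" 0] by auto
      ultimately show ?thesis
        using j False offset_in_window_iff[of 0 n j s] offset_in_window_iff[of 1 n j s] by auto
    next
      case False
      then show ?thesis
        using window_subset[of n s] window_subset[of n "Suc s"] by force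
    qed
  qed
qed

text \<open>Either the offset \<open>j\<close> of \<open>t\<close> from \<open>s\<close> is at most
  \<open>n\<close>, or the way from \<open>t\<close> on to \<open>s\<close> has length
  \<open>2 * n + 1 - j \<le> n\<close>. Up to swapping the windows, a rotation by at most
  \<open>n\<close> thus suffices.\<close>

lemma window_start_difference:
  fixes n s t :: nat
  obtains d where "d \<le> n" "window n t = window n (s + d)"
  | d where "d \<le> n" "window n s = window n (t + d)"
proof -
  obtain j where j: "j < 2 * n + 1" "t mod (2 * n + 1) = (s + j) mod (2 * n + 1)"
    using offset_exists[of "t mod (2 * n + 1)" "2 * n + 1" s] by auto
  show ?thesis
  proof (cases "j \<le> n")
    case True
    have "window n t = window n (s + j)"
      using window_mod j(2) by metis
    then show ?thesis
      using True that(1) by blast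
  next
    case False
    have "(t + (2 * n + 1 - j)) mod (2 * n + 1) = (s + j + (2 * n + 1 - j)) mod (2 * n + 1)"
      using j(2) by (metis mod_add_left_eq)
    also have "s + j + (2 * n + 1 - j) = s + (2 * n + 1)"
      using j(1) by simp
    also have "(s + (2 * n + 1)) mod (2 * n + 1) = s mod (2 * n + 1)"
      by (rule mod_add_self2)
    finally have "window n s = window n (t + (2 * n + 1 - j))"
      using window_mod by metis
    then show ?thesis
      using False that(2)[of "2 * n + 1 - j"] by simp
  qed
qed

text \<open>After a shift by \<open>d \<le> n\<close>, the start \<open>s + d\<close> of the later
  window still lies in the earlier one.\<close>

lemma windows_intersect: "window n s \<inter> window n t \<noteq> {}"
proof -
  have "window n s \<inter> window n (s + d) \<noteq> {}" if "d \<le> n" for s d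
    using that offset_in_window_iff[of 0 n d s] offset_in_window_iff[of d n d s] by auto
  then show ?thesis
    by (metis window_start_difference Int_commute)
qed

section \<open>Colorings of the cyclic circulant tournament\<close>

lemma verts_cyclic_circulant_tournament [simp]:
  "verts (cyclic_circulant_tournament n) = {..<2 * n + 1}"
  by (simp add: cyclic_circulant_tournament_def)

lemma arcs_ends_induced:
  "arcs_ends (cyclic_circulant_tournament n \<restriction> S) =
    {(a, (a + j) mod (2 * n + 1)) | a j. a \<in> {..<2 * n + 1} \<and> j \<in> {1..n}} \<inter> S \<times> S"
  by (auto simp: arcs_ends_conv cyclic_circulant_tournament_def image_iff)

text \<open>Arcs strictly increase the offset from \<open>s\<close>: for \<open>p \<le> n\<close>
  and \<open>j \<le> n\<close> the sum \<open>p + j\<close> does not wrap around.\<close>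

lemma acyclic_subset_window:
  assumes "S \<subseteq> window n s"
  shows "acyclic (arcs_ends (cyclic_circulant_tournament n \<restriction> S))"
proof -
  define offset where "offset x = (THE j. j \<le> n \<and> x = (s + j) mod (2 * n + 1))" for x
  have offset: "offset ((s + j) mod (2 * n + 1)) = j" if "j \<le> n" for j
    unfolding offset_def using that by (intro the_equality) (auto dest!: add_mod_inj)
  have "offset a < offset b"
    if ab: "(a, b) \<in> arcs_ends (cyclic_circulant_tournament n \<restriction> S)" for a b
  proof -
    from ab obtain j where j: "1 \<le> j" "j \<le> n" "b = (a + j) mod (2 * n + 1)" "a \<in> S" "b \<in> S"
      by (auto simp: arcs_ends_induced)
    then have "a \<in> window n s" "b \<in> window n s"
      using assms by blast+
    then obtain p q where p: "p \<le> n" "a = (s + p) mod (2 * n + 1)"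
      and q: "q \<le> n" "b = (s + q) mod (2 * n + 1)"
      unfolding window_def by blast
    have "(s + (p + j)) mod (2 * n + 1) = (s + q) mod (2 * n + 1)"
      using j(3) p(2) q(2) by (metis mod_add_left_eq add.assoc)
    then have "p + j = q"
      using j p q add_mod_inj[of s "p + j" "2 * n + 1" q] by simp
    then show ?thesis
      using offset p q j by auto
  qed
  \<comment> \<open>The order criterion asks for a value that decreases along the relation, hence
    the converse.\<close>
  then have "acyclic ((arcs_ends (cyclic_circulant_tournament n \<restriction> S))\<inverse>)"
    by (intro acyclicI_order[where f = offset]) auto
  then show ?thesis
    by simp
qed

text \<open>A source \<open>s\<close> of the set is a suitable start: a member at an offset
  \<open>j > n\<close> from \<open>s\<close> would have an arc to \<open>s\<close>, because
  \<open>2 * n + 1 - j\<close> lies between 1 and \<open>n\<close>.\<close>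

lemma acyclic_imp_subset_window:
  assumes "S \<subseteq> {..<2 * n + 1}" "acyclic (arcs_ends (cyclic_circulant_tournament n \<restriction> S))"
  obtains s where "S \<subseteq> window n s"
proof (cases "S = {}")
  case True
  then show ?thesis using that by auto
next
  case False
  let ?A = "arcs_ends (cyclic_circulant_tournament n \<restriction> S)"
  have "finite ?A"
    using finite_subset[OF assms(1)] by (auto simp: arcs_ends_induced intro: finite_subset[of _ "S \<times> S"])
  then have "wf ?A"
    using assms(2) by (rule finite_acyclic_wf)
  then obtain s where s: "s \<in> S" "\<And>y. (y, s) \<in> ?A \<Longrightarrow> y \<notin> S"
    using False by (metis wfE_min ex_in_conv)
  have "x \<in> window n s" if x: "x \<in> S" for x
  proof (rule ccontr)
    assume notin: "x \<notin> window n s"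
    obtain j where j: "j < 2 * n + 1" "x = (s + j) mod (2 * n + 1)"
      using x assms(1) by (auto elim: offset_exists[of _ _ s])
    with notin have "n < j"
      using offset_in_window_iff[of 0 n j s] by auto
    have "(x + (2 * n + 1 - j)) mod (2 * n + 1) = (s + j + (2 * n + 1 - j)) mod (2 * n + 1)"
      unfolding j(2) by (rule mod_add_left_eq)
    also have "s + j + (2 * n + 1 - j) = s + (2 * n + 1)"
      using j(1) by simp
    also have "(s + (2 * n + 1)) mod (2 * n + 1) = s"
      using s(1) assms(1) by (subst mod_add_self2) auto
    finally have *: "s = (x + (2 * n + 1 - j)) mod (2 * n + 1)" ..
    have "x \<in> {..<2 * n + 1}" "2 * n + 1 - j \<in> {1..n}"
      using x assms(1) j(1) \<open>n < j\<close> by auto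
    with * x s(1) have "(x, s) \<in> ?A"
      unfolding arcs_ends_induced by blast
    then show False
      using s(2) x by blast
  qed
  then show ?thesis
    using that by blast
qed

abbreviation colorings :: "nat \<Rightarrow> nat \<Rightarrow> (nat \<Rightarrow> nat) set" where
  "colorings k n \<equiv> dicolorings k (cyclic_circulant_tournament n)"

lemma colorings_iff:
  "\<alpha> \<in> colorings k n \<longleftrightarrow> \<alpha> \<in> {..<2 * n + 1} \<rightarrow>\<^sub>E {1..k} \<and>
    (\<forall>i\<in>{1..k}. \<exists>s. {x \<in> {..<2 * n + 1}. \<alpha> x = i} \<subseteq> window n s)"
proof -
  have "acyclic (arcs_ends (cyclic_circulant_tournament n \<restriction> {x \<in> {..<2 * n + 1}. \<alpha> x = i})) \<longleftrightarrow>
      (\<exists>s. {x \<in> {..<2 * n + 1}. \<alpha> x = i} \<subseteq> window n s)" for i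
    by (metis (no_types, lifting) acyclic_subset_window acyclic_imp_subset_window
        mem_Collect_eq subsetI)
  then show ?thesis
    unfolding dicolorings_def verts_cyclic_circulant_tournament by simp
qed

text \<open>All colors other than \<open>i\<close> share one window, so their distribution inside it
  is arbitrary. This is the freedom that the rotation exploits.\<close>

lemma coloringsI:
  assumes "\<alpha> \<in> {..<2 * n + 1} \<rightarrow>\<^sub>E {1..k}"
    and "{x \<in> {..<2 * n + 1}. \<alpha> x = i} \<subseteq> window n s"
    and "{x \<in> {..<2 * n + 1}. \<alpha> x \<noteq> i} \<subseteq> window n t"
  shows "\<alpha> \<in> colorings k n"
  unfolding colorings_iff
proof (intro conjI ballI assms(1))
  fix j
  show "\<exists>s. {x \<in> {..<2 * n + 1}. \<alpha> x = j} \<subseteq> window n s"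
  proof (cases "j = i")
    case False
    then have "{x \<in> {..<2 * n + 1}. \<alpha> x = j} \<subseteq> window n t"
      using assms(3) by auto
    then show ?thesis ..
  qed (use assms(2) in blast)
qed

text \<open>Needed because connectedness includes having a vertex. A window and its complement serve
  as the two classes.\<close>

lemma colorings_nonempty:
  assumes "k \<ge> 2"
  shows "colorings k n \<noteq> {}"
proof -
  let ?\<alpha> = "\<lambda>x\<in>{..<2 * n + 1}. if x \<in> window n 0 then 1 else 2 :: nat"
  have "?\<alpha> \<in> colorings k n"
    using assms window_complement[of 0 n] by (intro coloringsI[of _ _ _ 1 0 "n + 1"]) auto
  then show ?thesis by blast
qed

section \<open>Recoloring sequences\<close>

text \<open>The reflexive closure admits idle steps, so the \<open>m\<close>-th power expresses
  distance at most \<open>m\<close>, and sequences can be padded to a given length.\<close>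

abbreviation recoloring :: "nat \<Rightarrow> ('a, 'b) pre_digraph \<Rightarrow> (('a \<Rightarrow> nat) \<times> ('a \<Rightarrow> nat)) set" where
  "recoloring k D \<equiv> (arcs_ends (dicoloring_graph k D))\<^sup>="

lemma recoloring_upd:
  assumes "\<alpha> \<in> dicolorings k D" "\<alpha>(x := c) \<in> dicolorings k D" "x \<in> verts D"
  shows "(\<alpha>, \<alpha>(x := c)) \<in> recoloring k D"
proof (cases "\<alpha> x = c")
  case True
  then show ?thesis by (simp add: fun_upd_idem)
next
  case False
  then show ?thesis
    using assms by (auto simp: dicoloring_graph_def arcs_ends_conv image_iff)
qed

lemma recoloring_relpow_sym:
  assumes "(\<alpha>, \<beta>) \<in> recoloring k D ^^ m"
  shows "(\<beta>, \<alpha>) \<in> recoloring k D ^^ m"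
  using assms
proof (induction m arbitrary: \<alpha> \<beta>)
  case (Suc m)
  then obtain \<gamma> where "(\<alpha>, \<gamma>) \<in> recoloring k D ^^ m" "(\<gamma>, \<beta>) \<in> recoloring k D"
    by auto
  moreover from this(2) have "(\<beta>, \<gamma>) \<in> recoloring k D"
    using symmetric_dicoloring_graph[of k D] by (auto simp: symmetric_def sym_def)
  ultimately show ?case
    using Suc.IH by (blast intro: relpow_Suc_I2)
qed simp

lemma relpow_reflcl_mono:
  assumes "(x, y) \<in> R\<^sup>= ^^ l" "l \<le> m"
  shows "(x, y) \<in> R\<^sup>= ^^ m"
  using assms(2,1)
proof (induction rule: dec_induct)
  case (step m)
  then show ?case by auto
qed

text \<open>The vertices of \<open>S\<close> are recolored one at a time. Quantifying over all
  subsets covers every intermediate coloring, whatever the order.\<close>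

lemma recoloring_set:
  assumes "finite S" "S \<subseteq> verts D"
    and "\<And>T. T \<subseteq> S \<Longrightarrow> override_on \<alpha> \<beta> T \<in> dicolorings k D"
  shows "(\<alpha>, override_on \<alpha> \<beta> S) \<in> recoloring k D ^^ card S"
  using assms
proof (induction S rule: finite_induct)
  case (insert x S)
  have "(override_on \<alpha> \<beta> S, override_on \<alpha> \<beta> (insert x S)) \<in> recoloring k D"
    unfolding override_on_insert
  proof (rule recoloring_upd)
    show "override_on \<alpha> \<beta> S \<in> dicolorings k D"
      using insert.prems(2) by blast
    show "(override_on \<alpha> \<beta> S)(x := \<beta> x) \<in> dicolorings k D"
      using insert.prems(2)[of "insert x S"] by (simp only: override_on_insert subset_refl)
    show "x \<in> verts D"
      using insert.prems(1) by simp
  qed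
  moreover have "(\<alpha>, override_on \<alpha> \<beta> S) \<in> recoloring k D ^^ card S"
    using insert by auto
  ultimately show ?case
    using insert.hyps by auto
qed simp

text \<open>Colorings are extensional, so disagreement can occur only on vertices.\<close>

lemma coloring_eq_override_on:
  assumes "\<alpha> \<in> dicolorings k D" "\<beta> \<in> dicolorings k D"
    and "{x \<in> verts D. \<alpha> x \<noteq> \<beta> x} \<subseteq> S"
  shows "override_on \<alpha> \<beta> S = \<beta>"
proof
  fix x
  show "override_on \<alpha> \<beta> S x = \<beta> x"
    using assms by (cases "x \<in> verts D") (auto simp: override_on_def dicolorings_def PiE_def extensional_def)
qed

text \<open>Inside the window class \<open>i\<close> may grow freely, and every other class only
  shrinks; hence all intermediate colorings are admissible.\<close>

lemma recoloring_fill: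
  assumes \<alpha>: "\<alpha> \<in> colorings k n" and i: "i \<in> {1..k}"
    and sub: "{x \<in> {..<2 * n + 1}. \<alpha> x = i} \<subseteq> window n s"
  obtains \<gamma> where "\<gamma> \<in> colorings k n" "{x \<in> {..<2 * n + 1}. \<gamma> x = i} = window n s"
    "(\<alpha>, \<gamma>) \<in> recoloring k (cyclic_circulant_tournament n) ^^
       (n + 1 - card {x \<in> {..<2 * n + 1}. \<alpha> x = i})"
proof -
  let ?A = "{x \<in> {..<2 * n + 1}. \<alpha> x = i}"
  let ?\<gamma> = "override_on \<alpha> (\<lambda>_. i) (window n s - ?A)"
  have mix: "override_on \<alpha> (\<lambda>_. i) T \<in> colorings k n" if T: "T \<subseteq> window n s - ?A" for T
  proof -
    let ?\<delta> = "override_on \<alpha> (\<lambda>_. i) T"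
    have V: "T \<subseteq> {..<2 * n + 1}"
      using T window_subset by blast
    have "?\<delta> \<in> {..<2 * n + 1} \<rightarrow>\<^sub>E {1..k}"
      using \<alpha> i V unfolding colorings_iff
      by (auto simp: override_on_def PiE_iff extensional_def)
    moreover have "\<exists>s. {x \<in> {..<2 * n + 1}. ?\<delta> x = j} \<subseteq> window n s" if "j \<in> {1..k}" for j
    proof (cases "j = i")
      case True
      then have "{x \<in> {..<2 * n + 1}. ?\<delta> x = j} \<subseteq> window n s"
        using sub T by (auto simp: override_on_def split: if_splits)
      then show ?thesis ..
    next
      case False
      then have "{x \<in> {..<2 * n + 1}. ?\<delta> x = j} \<subseteq> {x \<in> {..<2 * n + 1}. \<alpha> x = j}"
        by (auto simp: override_on_def split: if_splits)
      then show ?thesis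
        using \<alpha> that unfolding colorings_iff by (meson order_trans)
    qed
    ultimately show ?thesis
      unfolding colorings_iff by blast
  qed
  have fin: "finite (window n s)"
    by (simp add: window_def)
  have "(\<alpha>, ?\<gamma>) \<in> recoloring k (cyclic_circulant_tournament n) ^^ card (window n s - ?A)"
    using fin window_subset mix by (intro recoloring_set) auto
  moreover have "card (window n s - ?A) \<le> n + 1 - card ?A"
    using card_Diff_subset[OF finite_subset[OF sub fin] sub] card_window_le[of n s] by linarith
  ultimately have "(\<alpha>, ?\<gamma>) \<in> recoloring k (cyclic_circulant_tournament n) ^^ (n + 1 - card ?A)"
    by (rule relpow_reflcl_mono)
  moreover have "{x \<in> {..<2 * n + 1}. ?\<gamma> x = i} = window n s"
    using sub window_subset[of n s] by (auto simp: override_on_def split: if_splits)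
  ultimately show ?thesis
    using that mix by blast
qed

section \<open>Rotation of a full window\<close>

lemma card_differ_upd:
  assumes "finite V" "x \<in> V" "\<alpha> x \<noteq> \<beta> x"
  shows "card {y \<in> V. \<alpha> y \<noteq> \<beta> y} = Suc (card {y \<in> V. (\<alpha>(x := \<beta> x)) y \<noteq> \<beta> y})"
proof -
  have "{y \<in> V. \<alpha> y \<noteq> \<beta> y} = insert x {y \<in> V. (\<alpha>(x := \<beta> x)) y \<noteq> \<beta> y}"
    using assms by auto
  then show ?thesis
    using assms(1) by simp
qed

text \<open>Induction on the remaining shift. Each round gives the first vertex \<open>a\<close> of
  the window and the next vertex \<open>b\<close> after it their final colors, and both were still
  wrong, so the number of disagreements drops by two.\<close>

lemma recoloring_rotate:
  assumes "\<gamma> \<in> colorings k n" "\<delta> \<in> colorings k n" "d \<le> n"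
    and "{x \<in> {..<2 * n + 1}. \<gamma> x = i} = window n s"
    and "{x \<in> {..<2 * n + 1}. \<delta> x = i} = window n (s + d)"
  shows "(\<gamma>, \<delta>) \<in> recoloring k (cyclic_circulant_tournament n) ^^
    card {x \<in> {..<2 * n + 1}. \<gamma> x \<noteq> \<delta> x}"
  using assms
proof (induction d arbitrary: \<gamma> s)
  case 0
  let ?S = "{x \<in> {..<2 * n + 1}. \<gamma> x \<noteq> \<delta> x}"
  have "(\<gamma>, override_on \<gamma> \<delta> ?S) \<in> recoloring k (cyclic_circulant_tournament n) ^^ card ?S"
  proof (rule recoloring_set)
    fix T assume T: "T \<subseteq> ?S"
    \<comment> \<open>Both classes of \<open>i\<close> are now the same window, so the disagreements
      lie in its complement and every mixture keeps class \<open>i\<close> unchanged.\<close>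
    have same: "override_on \<gamma> \<delta> T x = i \<longleftrightarrow> \<gamma> x = i" if "x < 2 * n + 1" for x
      using 0 that by (auto simp: override_on_def set_eq_iff)
    show "override_on \<gamma> \<delta> T \<in> colorings k n"
    proof (rule coloringsI)
      show "override_on \<gamma> \<delta> T \<in> {..<2 * n + 1} \<rightarrow>\<^sub>E {1..k}"
        using 0 T unfolding colorings_iff by (auto simp: override_on_def PiE_iff extensional_def)
      show "{x \<in> {..<2 * n + 1}. override_on \<gamma> \<delta> T x = i} \<subseteq> window n s"
        using 0 same by auto
      show "{x \<in> {..<2 * n + 1}. override_on \<gamma> \<delta> T x \<noteq> i} \<subseteq> window n (s + n + 1)"
        using 0 same window_complement[of s n] by blast
    qed
  qed auto
  then show ?case
    using 0 coloring_eq_override_on[of \<gamma> k "cyclic_circulant_tournament n" \<delta> ?S] by simp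
next
  case (Suc d)
  let ?N = "2 * n + 1"
  let ?R = "recoloring k (cyclic_circulant_tournament n)"
  define a where "a = s mod ?N"
  define b where "b = (s + n + 1) mod ?N"
  have aV: "a < ?N" and bV: "b < ?N"
    by (simp_all add: a_def b_def)
  have \<gamma>i: "\<gamma> x = i \<longleftrightarrow> x \<in> window n s" and \<delta>i: "\<delta> x = i \<longleftrightarrow> x \<in> window n (s + Suc d)"
    if "x < ?N" for x
    using Suc.prems(4,5) that by blast+
  have "a \<in> window n s" "a \<notin> window n (s + Suc d)"
    using offset_in_window_iff[of 0 n 0 s] offset_in_window_iff[of "Suc d" n 0 s] Suc.prems(3)
    by (auto simp: a_def)
  then have a: "\<gamma> a = i" "\<delta> a \<noteq> i"
    using \<gamma>i \<delta>i aV by auto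
  have "b \<notin> window n s" "b \<in> window n (s + Suc d)"
    using offset_in_window_iff[of 0 n "n + 1" s] offset_in_window_iff[of "Suc d" n "n + 1" s]
      Suc.prems(3) by (auto simp: b_def add.assoc)
  then have b: "\<gamma> b \<noteq> i" "\<delta> b = i"
    using \<gamma>i \<delta>i bV by auto
  have win: "window n (Suc s) = insert b (window n s - {a})"
    unfolding a_def b_def by (rule window_Suc)
  define \<gamma>\<^sub>1 where "\<gamma>\<^sub>1 = \<gamma>(a := \<delta> a)"
  define \<gamma>\<^sub>2 where "\<gamma>\<^sub>2 = \<gamma>\<^sub>1(b := \<delta> b)"
  have \<gamma>E: "\<gamma> \<in> {..<?N} \<rightarrow>\<^sub>E {1..k}" and \<delta>E: "\<delta> \<in> {..<?N} \<rightarrow>\<^sub>E {1..k}"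
    using Suc.prems(1,2) unfolding colorings_iff by auto
  have E1: "\<gamma>\<^sub>1 \<in> {..<?N} \<rightarrow>\<^sub>E {1..k}"
    unfolding \<gamma>\<^sub>1_def using \<gamma>E \<delta>E aV by (auto simp: PiE_iff extensional_def)
  then have E2: "\<gamma>\<^sub>2 \<in> {..<?N} \<rightarrow>\<^sub>E {1..k}"
    unfolding \<gamma>\<^sub>2_def using \<delta>E bV by (auto simp: PiE_iff extensional_def)
  have cls: "{x \<in> {..<?N}. \<gamma>\<^sub>2 x = i} = window n (Suc s)"
    using \<gamma>i a b aV bV window_subset[of n s]
    unfolding win \<gamma>\<^sub>2_def \<gamma>\<^sub>1_def by (auto split: if_splits)
  \<comment> \<open>The order matters: releasing \<open>a\<close> first leaves the other colors on
    the complement plus \<open>a\<close>, which is a window. Absorbing \<open>b\<close> first would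
    give color \<open>i\<close> to \<open>n + 2\<close> vertices, too many for a window.\<close>
  have \<gamma>1: "\<gamma>\<^sub>1 \<in> colorings k n"
  proof (rule coloringsI[OF E1])
    show "{x \<in> {..<?N}. \<gamma>\<^sub>1 x = i} \<subseteq> window n s"
      using \<gamma>i a unfolding \<gamma>\<^sub>1_def by (auto split: if_splits)
    have "{x \<in> {..<?N}. \<gamma>\<^sub>1 x \<noteq> i} \<subseteq> insert a ({..<?N} - window n s)"
      using \<gamma>i unfolding \<gamma>\<^sub>1_def by (auto split: if_splits)
    then show "{x \<in> {..<?N}. \<gamma>\<^sub>1 x \<noteq> i} \<subseteq> window n (s + n + 1)"
      using window_complement[of s n] unfolding a_def by blast
  qed
  have \<gamma>2: "\<gamma>\<^sub>2 \<in> colorings k n"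
  proof (rule coloringsI[OF E2])
    show "{x \<in> {..<?N}. \<gamma>\<^sub>2 x = i} \<subseteq> window n (Suc s)"
      using cls by simp
    show "{x \<in> {..<?N}. \<gamma>\<^sub>2 x \<noteq> i} \<subseteq> window n (Suc s + n + 1)"
      using cls window_complement[of "Suc s" n] by blast
  qed
  have "(\<gamma>, \<gamma>\<^sub>1) \<in> ?R"
    using recoloring_upd[OF Suc.prems(1)] \<gamma>1 aV unfolding \<gamma>\<^sub>1_def by simp
  moreover have "(\<gamma>\<^sub>1, \<gamma>\<^sub>2) \<in> ?R"
    using recoloring_upd[OF \<gamma>1] \<gamma>2 bV unfolding \<gamma>\<^sub>2_def by simp
  moreover have "(\<gamma>\<^sub>2, \<delta>) \<in> ?R ^^ card {x \<in> {..<?N}. \<gamma>\<^sub>2 x \<noteq> \<delta> x}"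
    using Suc.IH[OF \<gamma>2 Suc.prems(2) _ cls] Suc.prems(3,5) by simp
  ultimately have "(\<gamma>, \<delta>) \<in> ?R ^^ Suc (Suc (card {x \<in> {..<?N}. \<gamma>\<^sub>2 x \<noteq> \<delta> x}))"
    by (blast intro: relpow_Suc_I2)
  moreover have "card {x \<in> {..<?N}. \<gamma> x \<noteq> \<delta> x} = Suc (card {x \<in> {..<?N}. \<gamma>\<^sub>1 x \<noteq> \<delta> x})"
    using a aV unfolding \<gamma>\<^sub>1_def by (intro card_differ_upd) auto
  moreover have "card {x \<in> {..<?N}. \<gamma>\<^sub>1 x \<noteq> \<delta> x} = Suc (card {x \<in> {..<?N}. \<gamma>\<^sub>2 x \<noteq> \<delta> x})"
    using a b bV unfolding \<gamma>\<^sub>2_def by (intro card_differ_upd) (auto simp: \<gamma>\<^sub>1_def)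
  ultimately show ?case by simp
qed

lemma recoloring_between_windows:
  assumes "\<gamma> \<in> colorings k n" "\<delta> \<in> colorings k n"
    and "{x \<in> {..<2 * n + 1}. \<gamma> x = i} = window n s"
    and "{x \<in> {..<2 * n + 1}. \<delta> x = i} = window n t"
  shows "(\<gamma>, \<delta>) \<in> recoloring k (cyclic_circulant_tournament n) ^^ (2 * n)"
proof -
  let ?S = "{x \<in> {..<2 * n + 1}. \<gamma> x \<noteq> \<delta> x}"
  have "(\<gamma>, \<delta>) \<in> recoloring k (cyclic_circulant_tournament n) ^^ card ?S"
  proof (cases rule: window_start_difference[where n = n and s = s and t = t])
    case (1 d)
    then show ?thesis
      using assms by (intro recoloring_rotate) auto
  next
    \<comment> \<open>Rotation only runs forward, so here the sequence is built from
      \<open>\<delta>\<close> to \<open>\<gamma>\<close> and reversed.\<close>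
    case (2 d)
    have "?S = {x \<in> {..<2 * n + 1}. \<delta> x \<noteq> \<gamma> x}"
      by auto
    moreover have "(\<delta>, \<gamma>) \<in> recoloring k (cyclic_circulant_tournament n) ^^
        card {x \<in> {..<2 * n + 1}. \<delta> x \<noteq> \<gamma> x}"
      using assms 2 by (intro recoloring_rotate) auto
    ultimately show ?thesis
      by (simp only: recoloring_relpow_sym)
  qed
  moreover have "card ?S \<le> 2 * n"
  proof -
    \<comment> \<open>On a common vertex of the two windows both colorings have color
      \<open>i\<close>, so at least one of the \<open>2 * n + 1\<close> vertices agrees.\<close>
    obtain x where "x \<in> {x \<in> {..<2 * n + 1}. \<gamma> x = i}" "x \<in> {x \<in> {..<2 * n + 1}. \<delta> x = i}"
      unfolding assms(3,4) using windows_intersect by blast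
    then have "card ?S < card {..<2 * n + 1}"
      by (intro psubset_card_mono) auto
    then show ?thesis by simp
  qed
  ultimately show ?thesis
    by (rule relpow_reflcl_mono)
qed

lemma recoloring_any:
  assumes "\<alpha> \<in> colorings k n" "\<beta> \<in> colorings k n"
  shows "(\<alpha>, \<beta>) \<in> recoloring k (cyclic_circulant_tournament n) ^^ (4 * n + 1)"
proof -
  let ?R = "recoloring k (cyclic_circulant_tournament n)"
  \<comment> \<open>Taking a color that \<open>\<alpha>\<close> uses saves one step when its class
    is filled: \<open>n\<close> instead of \<open>n + 1\<close>. On the side of
    \<open>\<beta>\<close> the class of \<open>i\<close> may be empty, so the full
    \<open>n + 1\<close> is allowed there.\<close>
  define i where "i = \<alpha> 0"
  have i: "i \<in> {1..k}"
    using assms(1) unfolding colorings_iff i_def by (auto simp: PiE_iff)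
  obtain s t where s: "{x \<in> {..<2 * n + 1}. \<alpha> x = i} \<subseteq> window n s"
    and t: "{x \<in> {..<2 * n + 1}. \<beta> x = i} \<subseteq> window n t"
    using assms i unfolding colorings_iff by meson
  obtain \<gamma> where \<gamma>: "\<gamma> \<in> colorings k n" "{x \<in> {..<2 * n + 1}. \<gamma> x = i} = window n s"
      "(\<alpha>, \<gamma>) \<in> ?R ^^ (n + 1 - card {x \<in> {..<2 * n + 1}. \<alpha> x = i})"
    using recoloring_fill[OF assms(1) i s] .
  obtain \<delta> where \<delta>: "\<delta> \<in> colorings k n" "{x \<in> {..<2 * n + 1}. \<delta> x = i} = window n t"
      "(\<beta>, \<delta>) \<in> ?R ^^ (n + 1 - card {x \<in> {..<2 * n + 1}. \<beta> x = i})"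
    using recoloring_fill[OF assms(2) i t] .
  have "card {x \<in> {..<2 * n + 1}. \<alpha> x = i} > 0"
    by (auto simp: card_gt_0_iff i_def)
  then have "(\<alpha>, \<gamma>) \<in> ?R ^^ n"
    by (intro relpow_reflcl_mono[OF \<gamma>(3)]) linarith
  also have "(\<gamma>, \<delta>) \<in> ?R ^^ (2 * n)"
    using \<gamma> \<delta> by (intro recoloring_between_windows)
  also have "(\<delta>, \<beta>) \<in> ?R ^^ (n + 1)"
    by (rule relpow_reflcl_mono[OF recoloring_relpow_sym[OF \<delta>(3)]]) simp
  finally show ?thesis by simp
qed

section \<open>From recoloring sequences to walks\<close>

lemma (in wf_digraph) awalk_of_relpow:
  assumes "(u, v) \<in> (arcs_ends G)\<^sup>= ^^ m" "u \<in> verts G"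
  obtains p where "awalk u p v" "length p \<le> m"
proof -
  have "\<exists>p. awalk u p v \<and> length p \<le> m"
    using assms
  proof (induction m arbitrary: u)
    case 0
    then show ?case
      by (intro exI[of _ "[]"]) (auto simp: awalk_Nil_iff)
  next
    case (Suc m)
    then obtain w where w: "(u, w) \<in> (arcs_ends G)\<^sup>=" "(w, v) \<in> (arcs_ends G)\<^sup>= ^^ m"
      by (meson relpow_Suc_D2)
    show ?case
    proof (cases "u = w")
      \<comment> \<open>An idle step contributes no arc, so the walk may be shorter than the
        sequence.\<close>
      case True
      then show ?thesis
        using Suc.IH[of w] w Suc.prems by (metis le_SucI)
    next
      case False
      then obtain e where e: "e \<in> arcs G" "tail G e = u" "head G e = w"
        using w(1) by (auto simp: arcs_ends_conv)
      then obtain p where "awalk w p v" "length p \<le> m"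
        using Suc.IH[of w] w by auto
      then show ?thesis
        using e by (intro exI[of _ "e # p"]) (auto simp: awalk_Cons_iff)
    qed
  qed
  then show ?thesis
    using that by blast
qed

theorem theorem2:
  fixes n k :: nat
  assumes "n \<ge> 2" and "k \<ge> 3"
  shows "mixing k (cyclic_circulant_tournament n) \<and>
    diameter (dicoloring_graph k (cyclic_circulant_tournament n))
      \<le> ereal (real (4 * n + 1 + (n + 1) div 2))"
proof -
  let ?G = "dicoloring_graph k (cyclic_circulant_tournament n)"
  interpret wf_digraph ?G
    by (rule wf_digraph_dicoloring_graph)
  have verts: "verts ?G = colorings k n"
    by (simp add: dicoloring_graph_def)
  have walk: "\<exists>p. awalk \<alpha> p \<beta> \<and> length p \<le> 4 * n + 1" if "\<alpha> \<in> verts ?G" "\<beta> \<in> verts ?G" for \<alpha> \<beta>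
    using awalk_of_relpow[OF recoloring_any] that unfolding verts by metis
  \<comment> \<open>Connectedness is defined as strong connectedness of the symmetric closure, to
    which reachability in \<open>?G\<close> transfers.\<close>
  have "strongly_connected (mk_symmetric ?G)"
  proof (rule strongly_connectedI)
    show "verts (mk_symmetric ?G) \<noteq> {}"
      using colorings_nonempty[of k n] assms(2) verts by simp
    fix \<alpha> \<beta> assume "\<alpha> \<in> verts (mk_symmetric ?G)" "\<beta> \<in> verts (mk_symmetric ?G)"
    then have "\<alpha> \<rightarrow>\<^sup>*\<^bsub>?G\<^esub> \<beta>"
      using walk reachable_awalk by simp blast
    then show "\<alpha> \<rightarrow>\<^sup>*\<^bsub>mk_symmetric ?G\<^esub> \<beta>"
      by (rule reachable_mk_symmetricI)
  qed
  moreover have "\<mu> (\<lambda>_. 1) \<alpha> \<beta> \<le> ereal (real (4 * n + 1 + (n + 1) div 2))"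
    if "\<alpha> \<in> verts ?G" "\<beta> \<in> verts ?G" for \<alpha> \<beta>
  proof -
    from walk[OF that] obtain p where p: "awalk \<alpha> p \<beta>" "length p \<le> 4 * n + 1"
      by blast
    \<comment> \<open>With unit weights the cost of a walk is its length, so any single walk bounds
      the distance.\<close>
    have "\<mu> (\<lambda>_. 1) \<alpha> \<beta> \<le> awalk_cost (\<lambda>_. 1) p"
      using p(1) by (rule min_cost_le_walk_cost)
    also have "awalk_cost (\<lambda>_. 1) p = real (length p)"
      by (induction p) auto
    also have "ereal (real (length p)) \<le> ereal (real (4 * n + 1 + (n + 1) div 2))"
      using p(2) by simp
    finally show ?thesis .
  qed
  ultimately show ?thesis
    unfolding mixing_def connected_def diameter_def by (auto intro!: SUP_least)
qed

end
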